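(* Let $X$ be a Tychonoff space. If $X$ is $\kappa$-Fréchet--Urysohn, then $X$ is an Ascoli space.
   Context: A topological space $X$ is Tychonoff if it is completely regular and Hausdorff. A topological space $X$ is $\kappa$-Fréchet--Urysohn if for every open subset $U$ of $X$ and every $x\in\overline{U}$ there exists a sequence $\{x_n\}_{n\in\mathbb{N}}\subseteq U$ converging to $x$. For a Tychonoff space $X$, $C_k(X)$ denotes the space $C(X)$ of all real-valued continuous functions on $X$ endowed with the compact-open topology. A Tychonoff space $X$ is called an Ascoli space if every compact subset $\mathcal{K}$ of $C_k(X)$ is evenly continuous, i.e., the map $(f,x)\mapsto f(x)$ is continuous as a map from $\mathcal{K}\times X$ to $\mathbb{R}$. *)

theory Defs
  imports "HOL-Analysis.Analysis"
begin

definition Tychonoff_space :: "'a topology \<Rightarrow> bool" where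
  "Tychonoff_space X \<longleftrightarrow> completely_regular_space X \<and> Hausdorff_space X"

definition kappa_Frechet_Urysohn :: "'a topology \<Rightarrow> bool" where
  "kappa_Frechet_Urysohn X \<longleftrightarrow>
     (\<forall>U x. openin X U \<longrightarrow> x \<in> X closure_of U \<longrightarrow>
        (\<exists>s :: nat \<Rightarrow> 'a. range s \<subseteq> U \<and> limitin X s x sequentially))"

(* Functions are extensional on topspace X, so that two elements of cont_funs X
   agreeing on the space X are equal. *)
definition cont_funs :: "'a topology \<Rightarrow> ('a \<Rightarrow> real) set" where
  "cont_funs X = {f \<in> extensional (topspace X). continuous_map X euclideanreal f}"

(* The choice K = {} puts cont_funs X itself into the subbase, so that
   topspace (Ck X) = cont_funs X. *)
definition Ck :: "'a topology \<Rightarrow> ('a \<Rightarrow> real) topology" where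
  "Ck X = topology_generated_by
     {{f \<in> cont_funs X. f ` K \<subseteq> V} | K V. compactin X K \<and> open V}"

definition evenly_continuous :: "'a topology \<Rightarrow> ('a \<Rightarrow> real) set \<Rightarrow> bool" where
  "evenly_continuous X \<K> \<longleftrightarrow>
     continuous_map (prod_topology (subtopology (Ck X) \<K>) X) euclideanreal (\<lambda>(f, x). f x)"

definition Ascoli_space :: "'a topology \<Rightarrow> bool" where
  "Ascoli_space X \<longleftrightarrow>
     Tychonoff_space X \<and> (\<forall>\<K>. compactin (Ck X) \<K> \<longrightarrow> evenly_continuous X \<K>)"

lemma topspace_Ck: "topspace (Ck X) = cont_funs X"
proof -
  have "cont_funs X \<in> {{f \<in> cont_funs X. f ` K \<subseteq> V} | K V. compactin X K \<and> open V}"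
    by (rule CollectI, rule exI[of _ "{}"], rule exI[of _ UNIV]) auto
  then show ?thesis
    unfolding Ck_def topology_generated_by_topspace by blast
qed

end

theory Submission
  imports Defs
begin

text \<open>
  A compact \<open>\<K>\<close> that is not equicontinuous at \<open>x\<close> yields an \<open>\<epsilon> > 0\<close> such that \<open>x\<close> lies in the closure
  of the open set of points \<open>y\<close> with \<open>\<bar>f y - f x\<bar> > \<epsilon>\<close> for some \<open>f \<in> \<K>\<close>. A sequence \<open>y\<^sub>n\<close> in this set
  converging to \<open>x\<close>, with witnesses \<open>f\<^sub>n\<close>, is compact together with its limit. A cluster point \<open>f\<close> of
  \<open>f\<^sub>n\<close> varies by less than \<open>\<epsilon> / 2\<close> from \<open>f x\<close> on some tail of the sequence, and hence so do infinitely
  many \<open>f\<^sub>n\<close>, a contradiction. Equicontinuity gives continuity of evaluation.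
\<close>

lemma openin_Ck:
  assumes "compactin X K" "open V"
  shows "openin (Ck X) {f \<in> cont_funs X. f ` K \<subseteq> V}"
  unfolding Ck_def by (rule topology_generated_by_Basis) (use assms in blast)

lemma cont_funs_nhd:
  assumes "f \<in> cont_funs X" "x \<in> topspace X" "0 < (\<epsilon>::real)"
  obtains U where "openin X U" "x \<in> U" "\<And>y. y \<in> U \<Longrightarrow> \<bar>f y - f x\<bar> < \<epsilon>"
proof
  have f: "continuous_map X euclideanreal f"
    using assms by (simp add: cont_funs_def)
  show "openin X {y \<in> topspace X. f y \<in> ball (f x) \<epsilon>}"
    by (rule openin_continuous_map_preimage[OF f]) simp
qed (use assms in \<open>auto simp: dist_real_def\<close>)

lemma kappa_Frechet_Urysohn_imp_equicontinuous:
  assumes X: "kappa_Frechet_Urysohn X" and K: "compactin (Ck X) \<K>"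
    and x: "x \<in> topspace X" and "0 < (\<epsilon>::real)"
  obtains U where "openin X U" "x \<in> U" "\<And>f y. f \<in> \<K> \<Longrightarrow> y \<in> U \<Longrightarrow> \<bar>f y - f x\<bar> \<le> \<epsilon>"
proof -
  have K_sub: "\<K> \<subseteq> cont_funs X"
    using compactin_subset_topspace[OF K] by (simp add: topspace_Ck)
  \<comment> \<open>The complement of the closed ball makes the inequality strict, so
    \<open>V\<close> is a union of open preimages and the sequence property applies to it; hence the
    non-strict bound in the conclusion.\<close>
  define V where "V = (\<Union>f\<in>\<K>. {y \<in> topspace X. f y \<in> - cball (f x) \<epsilon>})"
  have V_iff: "y \<in> V \<longleftrightarrow> y \<in> topspace X \<and> (\<exists>f\<in>\<K>. \<epsilon> < \<bar>f y - f x\<bar>)" for y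
    by (auto simp: V_def dist_real_def abs_minus_commute not_le)
  have "openin X V"
    unfolding V_def
  proof (intro openin_Union ballI, elim imageE)
    fix S f assume S: "S = {y \<in> topspace X. f y \<in> - cball (f x) \<epsilon>}" and "f \<in> \<K>"
    then have "continuous_map X euclideanreal f"
      using K_sub by (auto simp: cont_funs_def)
    then show "openin X S"
      unfolding S by (rule openin_continuous_map_preimage) (simp add: open_Compl)
  qed
  have "x \<notin> X closure_of V"
  proof
    assume "x \<in> X closure_of V"
    with X \<open>openin X V\<close> obtain s where s: "range s \<subseteq> V" "limitin X s x sequentially"
      unfolding kappa_Frechet_Urysohn_def by blast
    then have "\<forall>n. \<exists>f\<in>\<K>. \<epsilon> < \<bar>f (s n) - f x\<bar>"
      using V_iff by blast
    then obtain F where F: "\<And>n. F n \<in> \<K>" "\<And>n. \<epsilon> < \<bar>F n (s n) - F n x\<bar>"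
      by metis
    \<comment> \<open>Values at \<open>x\<close> and on the tail are compared with the same number
      \<open>f x\<close>, so for each \<open>g\<close> in \<open>W N f\<close> the values on the
      tail differ from \<open>g x\<close> by less than \<epsilon>. The tail is compact together with
      its limit, so \<open>W N f\<close> is open.\<close>
    define W where
      "W N f = {g \<in> cont_funs X. g ` insert x (range (\<lambda>n. s (n + N))) \<subseteq> ball (f x) (\<epsilon> / 2)}" for N f
    have open_W: "openin (Ck X) (W N f)" for N f
      unfolding W_def
    proof (rule openin_Ck)
      show "compactin X (insert x (range (\<lambda>n. s (n + N))))"
        by (rule compactin_sequence_with_limit) (use s V_iff in \<open>auto intro: limitin_sequentially_offset\<close>)
    qed simp
    have "\<exists>N. f \<in> W N f" if "f \<in> \<K>" for f
    proof -
      have f: "f \<in> cont_funs X"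
        using that K_sub by blast
      obtain U where U: "openin X U" "x \<in> U" "\<And>y. y \<in> U \<Longrightarrow> \<bar>f y - f x\<bar> < \<epsilon> / 2"
        using cont_funs_nhd[OF f x, of "\<epsilon> / 2"] \<open>0 < \<epsilon>\<close> by auto
      obtain N where N: "\<And>n. N \<le> n \<Longrightarrow> s n \<in> U"
        using s(2) U(1,2) unfolding limitin_sequentially by blast
      have "f y \<in> ball (f x) (\<epsilon> / 2)" if "y \<in> insert x (range (\<lambda>n. s (n + N)))" for y
      proof -
        have "y \<in> U"
          using that N U(2) by auto
        from U(3)[OF this] show ?thesis
          by (simp add: dist_real_def abs_minus_commute)
      qed
      then show ?thesis
        using f unfolding W_def by blast
    qed
    then obtain N where N: "\<And>f. f \<in> \<K> \<Longrightarrow> f \<in> W (N f) f"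
      by metis
    \<comment> \<open>A finite subcover does the work of the cluster point: each \<open>F n\<close>
      falls into one of finitely many sets \<open>W (N f) f\<close>.\<close>
    have "\<And>S. S \<in> (\<lambda>f. W (N f) f) ` \<K> \<Longrightarrow> openin (Ck X) S" "\<K> \<subseteq> \<Union>((\<lambda>f. W (N f) f) ` \<K>)"
      using open_W N by blast+
    from compactinD[OF K this] obtain \<F>
      where "finite \<F>" "\<F> \<subseteq> (\<lambda>f. W (N f) f) ` \<K>" "\<K> \<subseteq> \<Union>\<F>"
      by blast
    then obtain \<G> where G: "finite \<G>" "\<G> \<subseteq> \<K>" "\<K> \<subseteq> (\<Union>f\<in>\<G>. W (N f) f)"
      using finite_subset_image[of \<F> "\<lambda>f. W (N f) f" \<K>] by blast
    \<comment> \<open>This \<open>n\<close> is chosen before \<open>f\<close>: it bounds every index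
      in the subcover, so \<open>s n\<close> lies in the tail of whichever set contains
      \<open>F n\<close>.\<close>
    define n where "n = Max (N ` \<G>)"
    obtain f where f: "f \<in> \<G>" "F n \<in> W (N f) f"
      using G F by blast
    have "N f \<le> n"
      using f G by (simp add: n_def)
    then have "s n \<in> range (\<lambda>k. s (k + N f))"
      by (intro range_eqI[of _ _ "n - N f"]) simp
    with f(2) have "F n (s n) \<in> ball (f x) (\<epsilon> / 2)" "F n x \<in> ball (f x) (\<epsilon> / 2)"
      unfolding W_def by blast+
    with F(2)[of n] show False
      unfolding mem_ball dist_real_def by linarith
  qed
  then obtain U where U: "openin X U" "x \<in> U" "U \<inter> V = {}"
    using x by (auto simp: in_closure_of)
  show ?thesis
  proof
    show "\<bar>f y - f x\<bar> \<le> \<epsilon>" if "f \<in> \<K>" "y \<in> U" for f y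
      using that U(3) V_iff[of y] openin_subset[OF U(1)] by (meson disjoint_iff not_le subsetD)
  qed (use U in auto)
qed

text \<open>Near \<open>(f, x)\<close> the error is at most
  \<open>\<bar>f x - g x\<bar> + \<bar>g x - g y\<bar>\<close>: closeness of \<open>g\<close> to
  \<open>f\<close> at \<open>x\<close> controls the first term, equicontinuity the second, uniformly
  in \<open>g\<close>.\<close>

lemma equicontinuous_imp_evenly_continuous:
  assumes K_sub: "\<K> \<subseteq> cont_funs X"
    and equi: "\<And>x \<epsilon>::real. x \<in> topspace X \<Longrightarrow> 0 < \<epsilon> \<Longrightarrow>
      \<exists>U. openin X U \<and> x \<in> U \<and> (\<forall>f\<in>\<K>. \<forall>y\<in>U. \<bar>f y - f x\<bar> \<le> \<epsilon>)"
  shows "evenly_continuous X \<K>"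
proof -
  let ?T = "prod_topology (subtopology (Ck X) \<K>) X"
  have "continuous_map ?T Met_TC.mtopology (\<lambda>(f, x). f x :: real)"
    unfolding Met_TC.continuous_map_to_metric
  proof (intro ballI allI impI)
    fix z and \<epsilon> :: real assume "z \<in> topspace ?T" "0 < \<epsilon>"
    then obtain f x where z: "z = (f, x)" "f \<in> \<K>" "x \<in> topspace X"
      by (auto simp: topspace_prod_topology)
    obtain U where U: "openin X U" "x \<in> U" "\<And>g y. g \<in> \<K> \<Longrightarrow> y \<in> U \<Longrightarrow> \<bar>g y - g x\<bar> \<le> \<epsilon> / 2"
      using equi[OF z(3), of "\<epsilon> / 2"] \<open>0 < \<epsilon>\<close> by auto
    \<comment> \<open>The compact set \<open>{x}\<close> suffices here, and the strict bound from
      \<open>W\<close> compensates for the non-strict one on \<open>U\<close>.\<close>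
    define W where "W = {g \<in> cont_funs X. g ` {x} \<subseteq> ball (f x) (\<epsilon> / 2)}"
    have "openin (Ck X) W"
      unfolding W_def using z by (intro openin_Ck) auto
    then have "openin ?T ((\<K> \<inter> W) \<times> U)"
      using U by (simp add: openin_prod_Times_iff openin_subtopology_Int2)
    moreover have "z \<in> (\<K> \<inter> W) \<times> U"
      using z U K_sub \<open>0 < \<epsilon>\<close> by (auto simp: W_def)
    moreover have "(case p of (g, y) \<Rightarrow> g y) \<in> ball (f x) \<epsilon>" if p: "p \<in> (\<K> \<inter> W) \<times> U" for p
    proof -
      obtain g y where g: "p = (g, y)" "g \<in> \<K>" "g \<in> W" "y \<in> U"
        using p by blast
      then have "\<bar>f x - g x\<bar> < \<epsilon> / 2"
        by (simp add: W_def dist_real_def)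
      with U(3)[OF g(2,4)] have "\<bar>f x - g y\<bar> < \<epsilon>"
        by linarith
      with g(1) show ?thesis
        by (simp add: dist_real_def)
    qed
    ultimately show "\<exists>U. openin ?T U \<and> z \<in> U \<and>
        (\<forall>p\<in>U. (case p of (g, y) \<Rightarrow> g y) \<in> Met_TC.mball (case z of (g, y) \<Rightarrow> g y) \<epsilon>)"
      using z(1) by auto
  qed
  then show ?thesis
    by (simp add: evenly_continuous_def)
qed

theorem theorem1p3:
  fixes X :: "'a topology"
  assumes "Tychonoff_space X" and "kappa_Frechet_Urysohn X"
  shows "Ascoli_space X"
  unfolding Ascoli_space_def
proof (intro conjI allI impI)
  fix \<K> assume K: "compactin (Ck X) \<K>"
  show "evenly_continuous X \<K>"
  proof (rule equicontinuous_imp_evenly_continuous)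
    show "\<K> \<subseteq> cont_funs X"
      using compactin_subset_topspace[OF K] by (simp add: topspace_Ck)
  next
    fix x and \<epsilon> :: real assume "x \<in> topspace X" "0 < \<epsilon>"
    then obtain U where "openin X U" "x \<in> U" "\<And>f y. f \<in> \<K> \<Longrightarrow> y \<in> U \<Longrightarrow> \<bar>f y - f x\<bar> \<le> \<epsilon>"
      using kappa_Frechet_Urysohn_imp_equicontinuous[OF assms(2) K] by metis
    then show "\<exists>U. openin X U \<and> x \<in> U \<and> (\<forall>f\<in>\<K>. \<forall>y\<in>U. \<bar>f y - f x\<bar> \<le> \<epsilon>)"
      by blast
  qed
qed (rule assms(1))

end
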